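(* The permutation statistic $(a-cb)+(b-ca)+(b-ca)+(ba)$ (in which the pattern $b-ca$ is counted twice) is Mahonian; that is, for every $n\ge1$ and every integer $k$, the number of $\pi\in\mathfrak S_n$ with $(a-cb)\,\pi+2\,(b-ca)\,\pi+(ba)\,\pi=k$ equals the number of $\pi\in\mathfrak S_n$ with $\mathrm{inv}\,\pi=k$.
   Context: $\mathfrak S_n$ is the set of permutations $\pi=\pi_1\cdots\pi_n$ of $\{1,\dots,n\}$; $\mathrm{inv}\,\pi=\#\{(i,j):1\le i<j\le n,\ \pi_i>\pi_j\}$. Vincular pattern counts: $(a-cb)\,\pi=\#\{(i,j):i<j<n,\ \pi_i<\pi_{j+1}<\pi_j\}$; $(b-ca)\,\pi=\#\{(i,j):i<j<n,\ \pi_{j+1}<\pi_i<\pi_j\}$; $(ba)\,\pi=\#\{i<n:\pi_i>\pi_{i+1}\}$. A sum of patterns denotes the sum of their counts (with multiplicity). *)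

theory Defs
  imports "HOL-Combinatorics.Permutations"
begin

text \<open>
  Permutations of \<open>{1..n}\<close> are functions \<open>p\<close> with \<open>p permutes {1..n}\<close>; the word of \<open>p\<close>
  is \<open>p 1, \<dots>, p n\<close>. Each statistic takes the length \<open>n\<close> as its first argument.
\<close>

definition inv_count :: "nat \<Rightarrow> (nat \<Rightarrow> nat) \<Rightarrow> nat" where
  "inv_count n p = card {(i, j). 1 \<le> i \<and> i < j \<and> j \<le> n \<and> p i > p j}"

definition pat_a_cb :: "nat \<Rightarrow> (nat \<Rightarrow> nat) \<Rightarrow> nat" where
  "pat_a_cb n p = card {(i, j). 1 \<le> i \<and> i < j \<and> j < n \<and> p i < p (j + 1) \<and> p (j + 1) < p j}"

definition pat_b_ca :: "nat \<Rightarrow> (nat \<Rightarrow> nat) \<Rightarrow> nat" where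
  "pat_b_ca n p = card {(i, j). 1 \<le> i \<and> i < j \<and> j < n \<and> p (j + 1) < p i \<and> p i < p j}"

definition pat_ba :: "nat \<Rightarrow> (nat \<Rightarrow> nat) \<Rightarrow> nat" where
  "pat_ba n p = card {i. 1 \<le> i \<and> i < n \<and> p i > p (i + 1)}"

definition mahonian :: "(nat \<Rightarrow> (nat \<Rightarrow> nat) \<Rightarrow> nat) \<Rightarrow> bool" where
  "mahonian stat \<longleftrightarrow>
     (\<forall>n\<ge>1. \<forall>k::int. card {p. p permutes {1..n} \<and> int (stat n p) = k}
                     = card {p. p permutes {1..n} \<and> int (inv_count n p) = k})"

end

theory Submission
  imports Defs
begin

text \<open>
  Encode a permutation \<open>p\<close> by \<open>r\<^sub>j = #{i < j. p i < p j}\<close>, a bijection onto the sequences with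
  \<open>0 \<le> r\<^sub>j < j\<close>. A descent at \<open>j\<close> means \<open>r\<^sub>j\<^sub>+\<^sub>1 \<le> r\<^sub>j\<close> and contributes \<open>2 r\<^sub>j - r\<^sub>j\<^sub>+\<^sub>1 + 1\<close> to the
  statistic. Putting \<open>t\<^sub>j = r\<^sub>j\<^sub>+\<^sub>1 - r\<^sub>j - 1\<close> at ascents and \<open>t\<^sub>j = r\<^sub>j\<close> at descents, the
  contributions telescope to \<open>(n - 1 - r\<^sub>n) + \<Sum>\<^sub>j\<^sub><\<^sub>n t\<^sub>j\<close>. For fixed \<open>r\<^sub>j\<^sub>+\<^sub>1\<close> the map from \<open>r\<^sub>j\<close> to \<open>t\<^sub>j\<close>
  permutes \<open>{0, \<dots>, j - 1}\<close>, so \<open>r \<mapsto> (t\<^sub>1, \<dots>, t\<^sub>n\<^sub>-\<^sub>1, n - 1 - r\<^sub>n)\<close> is a bijection of the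
  sequences, just like \<open>r\<^sub>j \<mapsto> j - 1 - r\<^sub>j\<close>, which turns the sum into \<open>inv\<close>.
\<close>

definition left_rank :: "(nat \<Rightarrow> nat) \<Rightarrow> nat \<Rightarrow> nat" where
  "left_rank p j = card {i \<in> {1..<j}. p i < p j}"

text \<open>Extensional functions make the set finite, with \<open>n!\<close> elements, and let
  equality be checked on the entries alone.\<close>

definition codes :: "nat \<Rightarrow> (nat \<Rightarrow> nat) set" where
  "codes n = (\<Pi>\<^sub>E j\<in>{1..n}. {..<j})"

definition code :: "nat \<Rightarrow> (nat \<Rightarrow> nat) \<Rightarrow> nat \<Rightarrow> nat" where
  "code n p = restrict (left_rank p) {1..n}"

definition co_code :: "nat \<Rightarrow> (nat \<Rightarrow> nat) \<Rightarrow> nat \<Rightarrow> nat" where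
  "co_code n r = (\<lambda>j\<in>{1..n}. j - 1 - r j)"

definition step :: "nat \<Rightarrow> nat \<Rightarrow> nat" where
  "step x y = (if x < y then y - x - 1 else x)"

definition step_code :: "nat \<Rightarrow> (nat \<Rightarrow> nat) \<Rightarrow> nat \<Rightarrow> nat" where
  "step_code n r = (\<lambda>j\<in>{1..n}. if j = n then n - 1 - r n else step (r j) (r (j + 1)))"

section \<open>Permutations correspond to codes\<close>

lemma finite_codes [simp]: "finite (codes n)"
  unfolding codes_def by (rule finite_PiE) auto

lemma card_codes: "card (codes n) = fact n"
  unfolding codes_def by (simp add: card_PiE fact_prod)

lemma codes_less: "r \<in> codes n \<Longrightarrow> 1 \<le> j \<Longrightarrow> j \<le> n \<Longrightarrow> r j < j"
  unfolding codes_def by (auto simp: PiE_iff)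

lemma codes_eqI:
  assumes "r \<in> codes n" "s \<in> codes n" "\<And>j. 1 \<le> j \<Longrightarrow> j \<le> n \<Longrightarrow> r j = s j"
  shows "r = s"
  using assms unfolding codes_def by (intro PiE_ext) auto

lemma left_rank_less: "1 \<le> j \<Longrightarrow> left_rank p j < j"
proof -
  assume "1 \<le> j"
  have "left_rank p j \<le> card {1..<j}"
    unfolding left_rank_def by (rule card_mono) auto
  with \<open>1 \<le> j\<close> show ?thesis by simp
qed

lemma code_in_codes: "code n p \<in> codes n"
  unfolding code_def codes_def using left_rank_less by (auto simp: PiE_iff)

text \<open>The sets of earlier positions with value below a bound grow with the bound, and
  \<open>i\<close> itself makes the growth strict. So the new entry's left rank and the order of the
  earlier entries fix its place among them.\<close>

lemma less_iff_rank_less_left_rank: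
  assumes "i \<in> {1..<m}"
  shows "p i < p m \<longleftrightarrow> card {l \<in> {1..<m}. p l < p i} < left_rank p m"
proof
  assume less: "p i < p m"
  have "{l \<in> {1..<m}. p l < p i} \<subseteq> {l \<in> {1..<m}. p l < p m}" using less by auto
  moreover have "i \<in> {l \<in> {1..<m}. p l < p m}" "i \<notin> {l \<in> {1..<m}. p l < p i}"
    using assms less by auto
  ultimately have "{l \<in> {1..<m}. p l < p i} \<subset> {l \<in> {1..<m}. p l < p m}" by blast
  then show "card {l \<in> {1..<m}. p l < p i} < left_rank p m"
    unfolding left_rank_def by (intro psubset_card_mono) auto
next
  assume less: "card {l \<in> {1..<m}. p l < p i} < left_rank p m"
  show "p i < p m"
  proof (rule ccontr)
    assume "\<not> p i < p m"
    then have "left_rank p m \<le> card {l \<in> {1..<m}. p l < p i}"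
      unfolding left_rank_def by (intro card_mono) auto
    with less show False by simp
  qed
qed

text \<open>The prefix order, known by induction, gives the ranks within the prefix, so the left
  rank of the last entry settles its comparisons. Injectivity yields the reverse ones.\<close>

lemma left_rank_determines_order:
  fixes p q :: "nat \<Rightarrow> nat"
  assumes "inj_on p {1..n}" "inj_on q {1..n}"
    and "\<And>j. j \<in> {1..n} \<Longrightarrow> left_rank p j = left_rank q j"
    and "i \<in> {1..n}" "j \<in> {1..n}"
  shows "p i < p j \<longleftrightarrow> q i < q j"
  using assms
proof (induction n arbitrary: i j)
  case 0
  then show ?case by simp
next
  case (Suc n)
  have IH: "p i < p j \<longleftrightarrow> q i < q j" if "i \<in> {1..n}" "j \<in> {1..n}" for i j
    using Suc.prems(1-3) that by (intro Suc.IH) (auto intro: inj_on_subset)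
  have last: "p i < p (Suc n) \<longleftrightarrow> q i < q (Suc n)" if "i \<in> {1..n}" for i
  proof -
    have "{l \<in> {1..<Suc n}. p l < p i} = {l \<in> {1..<Suc n}. q l < q i}"
      using IH that by auto
    then show ?thesis
      using less_iff_rank_less_left_rank[of i "Suc n"] Suc.prems(3)[of "Suc n"] that by simp
  qed
  have last': "p (Suc n) < p i \<longleftrightarrow> q (Suc n) < q i" if "i \<in> {1..n}" for i
  proof -
    have "p i \<noteq> p (Suc n)" "q i \<noteq> q (Suc n)"
      using Suc.prems(1,2) that by (auto dest: inj_onD)
    with last[OF that] show ?thesis by linarith
  qed
  show ?case
    using Suc.prems(4,5) IH last last' by (auto simp: le_Suc_eq)
qed

text \<open>The smaller entries take exactly the values \<open>1, ..., p i - 1\<close>. Hence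
  relative order alone recovers a permutation.\<close>

lemma permutes_value_eq_card:
  assumes "p permutes {1..n}" "i \<in> {1..n}"
  shows "p i = Suc (card {l \<in> {1..n}. p l < p i})"
proof -
  have "p i \<in> {1..n}" using assms(2) by (simp only: permutes_in_image[OF assms(1)])
  have "p ` {l \<in> {1..n}. p l < p i} = {v \<in> p ` {1..n}. v < p i}" by blast
  also have "\<dots> = {1..<p i}"
    unfolding permutes_image[OF assms(1)] using \<open>p i \<in> {1..n}\<close> by auto
  finally have "p ` {l \<in> {1..n}. p l < p i} = {1..<p i}" .
  moreover have "inj_on p {l \<in> {1..n}. p l < p i}"
    using permutes_inj_on[OF assms(1)] by blast
  ultimately have "card {l \<in> {1..n}. p l < p i} = card {1..<p i}"
    by (metis card_image)
  with \<open>p i \<in> {1..n}\<close> show ?thesis by simp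
qed

lemma inj_on_code: "inj_on (code n) {p. p permutes {1..n}}"
proof (rule inj_onI, clarify)
  fix p q
  assume p: "p permutes {1..n}" and q: "q permutes {1..n}" and eq: "code n p = code n q"
  have "left_rank p j = left_rank q j" if "j \<in> {1..n}" for j
    using fun_cong[OF eq, of j] that by (simp add: code_def)
  then have order: "p i < p j \<longleftrightarrow> q i < q j" if "i \<in> {1..n}" "j \<in> {1..n}" for i j
    by (rule left_rank_determines_order[OF permutes_inj_on[OF p] permutes_inj_on[OF q] _ that])
  show "p = q"
  proof
    fix i
    show "p i = q i"
    proof (cases "i \<in> {1..n}")
      case True
      then have "{l \<in> {1..n}. p l < p i} = {l \<in> {1..n}. q l < q i}" using order by blast
      then show ?thesis
        using permutes_value_eq_card[OF p True] permutes_value_eq_card[OF q True] by simp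
    next
      case False
      then show ?thesis using p q by (simp add: permutes_not_in)
    qed
  qed
qed

text \<open>Surjectivity comes from counting: both sides have \<open>n!\<close> elements.\<close>

lemma bij_betw_code: "bij_betw (code n) {p. p permutes {1..n}} (codes n)"
proof -
  have "card (code n ` {p. p permutes {1..n}}) = card (codes n)"
    unfolding card_image[OF inj_on_code] card_codes by (rule card_permutations) simp_all
  then have "code n ` {p. p permutes {1..n}} = codes n"
    using code_in_codes by (intro card_subset_eq) auto
  then show ?thesis using inj_on_code by (simp add: bij_betw_def)
qed

section \<open>Two bijections of the codes onto themselves\<close>

lemma bij_betw_co_code: "bij_betw (co_code n) (codes n) (codes n)"
proof -
  have "inj_on (co_code n) (codes n)"
  proof (rule inj_onI, rule codes_eqI)
    fix r s j
    assume rs: "r \<in> codes n" "s \<in> codes n" "co_code n r = co_code n s" and j: "1 \<le> j" "j \<le> n"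
    have "j - 1 - r j = j - 1 - s j"
      using fun_cong[OF rs(3), of j] j by (simp add: co_code_def)
    \<comment> \<open>Entries lie below \<open>j\<close>, so truncated subtraction loses
      nothing.\<close>
    then show "r j = s j"
      using codes_less[OF rs(1) j] codes_less[OF rs(2) j] by linarith
  qed
  moreover have "co_code n ` codes n \<subseteq> codes n"
    by (auto simp: codes_def co_code_def)
  ultimately show ?thesis
    by (simp add: bij_betw_def endo_inj_surj)
qed

lemma step_less: "x < j \<Longrightarrow> y \<le> j \<Longrightarrow> step x y < j"
  by (auto simp: step_def)

text \<open>For fixed \<open>y\<close>, the values \<open>x < y\<close> are reversed within
  \<open>{0..<y}\<close> and those with \<open>x >= y\<close> stay fixed.\<close>

lemma step_inject: "step x y = step x' y \<longleftrightarrow> x = x'"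
  by (auto simp: step_def)

text \<open>Decoding runs from right to left: the last entry gives \<open>r n\<close>, and once
  \<open>r (m + 1)\<close> is known, \<open>step_inject\<close> gives \<open>r m\<close>. An
  injective self-map of a finite set is onto.\<close>

lemma bij_betw_step_code: "bij_betw (step_code n) (codes n) (codes n)"
proof -
  have "inj_on (step_code n) (codes n)"
  proof (rule inj_onI, rule codes_eqI)
    fix r s j
    assume rs: "r \<in> codes n" "s \<in> codes n" and eq: "step_code n r = step_code n s"
      and j: "1 \<le> j" "j \<le> n"
    show "r j = s j"
      using j(2,1)
    proof (induction j rule: inc_induct)
      case base
      have "n - 1 - r n = n - 1 - s n"
        using fun_cong[OF eq, of n] base by (simp add: step_code_def)
      then show ?case
        using codes_less[OF rs(1) base] codes_less[OF rs(2) base] by simp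
    next
      case (step m)
      then have "step (r m) (r (Suc m)) = step (s m) (s (Suc m))" "r (Suc m) = s (Suc m)"
        using fun_cong[OF eq, of m] by (simp_all add: step_code_def)
      then show ?case by (simp add: step_inject)
    qed
  qed
  moreover have "step_code n r \<in> codes n" if r: "r \<in> codes n" for r
  proof -
    \<comment> \<open>The code bound \<open>r (Suc j) < Suc j\<close> is exactly the condition
      \<open>y <= j\<close> of \<open>step_less\<close>.\<close>
    have "step (r j) (r (Suc j)) < j" if "1 \<le> j" "j < n" for j
      using codes_less[OF r, of j] codes_less[OF r, of "Suc j"] that by (intro step_less) auto
    then show ?thesis
      by (auto simp: codes_def step_code_def PiE_iff)
  qed
  ultimately show ?thesis
    by (simp add: bij_betw_def endo_inj_surj image_subsetI)
qed

section \<open>The statistics as sums of code entries\<close>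

lemma card_pairs_eq_sum:
  assumes "finite J" "\<And>j. j \<in> J \<Longrightarrow> finite (I j)"
  shows "card {(i, j). j \<in> J \<and> i \<in> I j} = (\<Sum>j\<in>J. card (I j))"
proof -
  have "{(i, j). j \<in> J \<and> i \<in> I j} = prod.swap ` Sigma J I" by auto
  then show ?thesis using assms by (simp add: card_image)
qed

text \<open>Inversions are grouped by their right end: of the \<open>j - 1\<close> earlier entries,
  those not smaller than \<open>p j\<close> are larger.\<close>

lemma inv_count_eq_sum_code:
  assumes "p permutes {1..n}"
  shows "inv_count n p = (\<Sum>j\<in>{1..n}. co_code n (code n p) j)"
proof -
  have "{(i, j). 1 \<le> i \<and> i < j \<and> j \<le> n \<and> p i > p j}
      = {(i, j). j \<in> {1..n} \<and> i \<in> {i \<in> {1..<j}. p i > p j}}" by auto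
  then have "inv_count n p = (\<Sum>j\<in>{1..n}. card {i \<in> {1..<j}. p i > p j})"
    unfolding inv_count_def by (simp only:) (intro card_pairs_eq_sum; simp)
  also have "\<dots> = (\<Sum>j\<in>{1..n}. co_code n (code n p) j)"
  proof (rule sum.cong)
    fix j assume j: "j \<in> {1..n}"
    have "p i \<noteq> p j" if "i \<in> {1..<j}" for i
      using permutes_inj[OF assms] that by (simp add: inj_eq)
    then have "{i \<in> {1..<j}. p i > p j} = {1..<j} - {i \<in> {1..<j}. p i < p j}"
      by (force simp: nat_neq_iff)
    then have "card {i \<in> {1..<j}. p i > p j} = card ({1..<j} - {i \<in> {1..<j}. p i < p j})"
      by (rule arg_cong)
    also have "\<dots> = card {1..<j} - left_rank p j"
      unfolding left_rank_def by (rule card_Diff_subset) auto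
    finally have "card {i \<in> {1..<j}. p i > p j} = j - 1 - left_rank p j" by simp
    then show "card {i \<in> {1..<j}. p i > p j} = co_code n (code n p) j"
      using j by (simp add: co_code_def code_def)
  qed simp
  finally show ?thesis .
qed

definition descent_weight :: "nat \<Rightarrow> nat \<Rightarrow> nat" where
  "descent_weight x y = (if x < y then 0 else 2 * x - y + 1)"

text \<open>At a descent the left ranks are \<open>x = |A| + |B|\<close> and \<open>y = |A|\<close>,
  so \<open>|A| + 2|B| + 1 = 2x - y + 1\<close>. At an ascent both sets are empty and the rank
  strictly rises, so comparing ranks detects descents.\<close>

lemma pattern_sum_eq_sum_descent_weight:
  assumes "p permutes {1..n}"
  shows "pat_a_cb n p + pat_b_ca n p + pat_b_ca n p + pat_ba n p
    = (\<Sum>j\<in>{1..<n}. descent_weight (left_rank p j) (left_rank p (Suc j)))"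
proof -
  define A where "A j = {i \<in> {1..<j}. p i < p (Suc j) \<and> p (Suc j) < p j}" for j
  define B where "B j = {i \<in> {1..<j}. p (Suc j) < p i \<and> p i < p j}" for j
  define D where "D j = (if p (Suc j) < p j then 1 else 0 :: nat)" for j
  have fin: "finite (A j)" "finite (B j)" for j by (auto simp: A_def B_def)
  have "pat_a_cb n p = card {(i, j). j \<in> {1..<n} \<and> i \<in> A j}"
    unfolding pat_a_cb_def A_def by (rule arg_cong[of _ _ card]) auto
  then have a: "pat_a_cb n p = (\<Sum>j\<in>{1..<n}. card (A j))"
    using fin by (simp only: card_pairs_eq_sum finite_atLeastLessThan)
  have "pat_b_ca n p = card {(i, j). j \<in> {1..<n} \<and> i \<in> B j}"
    unfolding pat_b_ca_def B_def by (rule arg_cong[of _ _ card]) auto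
  then have b: "pat_b_ca n p = (\<Sum>j\<in>{1..<n}. card (B j))"
    using fin by (simp only: card_pairs_eq_sum finite_atLeastLessThan)
  have "pat_ba n p = card {j \<in> {1..<n}. p (Suc j) < p j}"
    unfolding pat_ba_def by (rule arg_cong[of _ _ card]) auto
  then have d: "pat_ba n p = (\<Sum>j\<in>{1..<n}. D j)"
    by (simp add: D_def sum.If_cases Int_def)
  have "card (A j) + card (B j) + card (B j) + D j
      = descent_weight (left_rank p j) (left_rank p (Suc j))" if j: "j \<in> {1..<n}" for j
  proof (cases "p (Suc j) < p j")
    case True
    have "p i \<noteq> p (Suc j)" if "i \<in> {1..<j}" for i
      using permutes_inj[OF assms] that by (simp add: inj_eq)
    then have split: "{i \<in> {1..<j}. p i < p j} = A j \<union> B j"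
      using True by (force simp: A_def B_def nat_neq_iff)
    have x: "left_rank p j = card (A j) + card (B j)"
      unfolding left_rank_def split using fin by (subst card_Un_disjoint) (auto simp: A_def B_def)
    \<comment> \<open>Position \<open>j\<close> drops out because \<open>p j\<close> exceeds
      \<open>p (Suc j)\<close>.\<close>
    have "{i \<in> {1..<Suc j}. p i < p (Suc j)} = A j"
      using True by (auto simp: A_def less_Suc_eq)
    then have "left_rank p (Suc j) = card (A j)"
      by (simp add: left_rank_def)
    then show ?thesis
      using x True by (simp add: descent_weight_def D_def)
  next
    case False
    have "p j \<noteq> p (Suc j)"
      using permutes_inj[OF assms] by (simp add: inj_eq)
    with False have less: "p j < p (Suc j)" by simp
    have "{i \<in> {1..<j}. p i < p j} \<subseteq> {i \<in> {1..<Suc j}. p i < p (Suc j)}" using less by auto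
    moreover have "j \<in> {i \<in> {1..<Suc j}. p i < p (Suc j)}" "j \<notin> {i \<in> {1..<j}. p i < p j}"
      using less j by auto
    ultimately have "{i \<in> {1..<j}. p i < p j} \<subset> {i \<in> {1..<Suc j}. p i < p (Suc j)}" by blast
    then have "left_rank p j < left_rank p (Suc j)"
      unfolding left_rank_def by (intro psubset_card_mono) auto
    moreover have "A j = {}" "B j = {}" using less by (auto simp: A_def B_def)
    ultimately show ?thesis
      using less by (simp add: descent_weight_def D_def)
  qed
  then show ?thesis
    unfolding a b d sum.distrib[symmetric] by (rule sum.cong[OF refl])
qed

text \<open>The remainder \<open>m - 1 - r m\<close> acts as a potential: passing to
  \<open>m + 1\<close> changes it by just the difference between \<open>descent_weight\<close> and
  \<open>step\<close>, at ascents and descents alike.\<close>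

lemma sum_descent_weight_eq:
  assumes "1 \<le> n" "\<And>j. 1 \<le> j \<Longrightarrow> j \<le> n \<Longrightarrow> r j < j"
  shows "(\<Sum>j\<in>{1..<n}. descent_weight (r j) (r (Suc j)))
    = (\<Sum>j\<in>{1..<n}. step (r j) (r (Suc j))) + (n - 1 - r n)"
  using assms
proof (induction n rule: dec_induct)
  case base
  then show ?case by simp
next
  case (step m)
  have "r m < m" "r (Suc m) < Suc m" using step by auto
  then have "descent_weight (r m) (r (Suc m)) + (m - 1 - r m)
      = step (r m) (r (Suc m)) + (m - r (Suc m))"
    by (auto simp: descent_weight_def step_def)
  then show ?case using step by simp
qed

lemma pattern_sum_eq_sum_code:
  assumes "p permutes {1..n}" "1 \<le> n"
  shows "pat_a_cb n p + pat_b_ca n p + pat_b_ca n p + pat_ba n p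
    = (\<Sum>j\<in>{1..n}. step_code n (code n p) j)"
proof -
  have "(\<Sum>j\<in>{1..n}. step_code n (code n p) j)
      = (\<Sum>j\<in>{1..<n}. step_code n (code n p) j) + step_code n (code n p) n"
    using assms(2) by (simp add: sum.last_plus)
  also have "\<dots> = (\<Sum>j\<in>{1..<n}. step (left_rank p j) (left_rank p (Suc j)))
      + (n - 1 - left_rank p n)"
    using assms(2) by (simp add: step_code_def code_def)
  also have "\<dots> = (\<Sum>j\<in>{1..<n}. descent_weight (left_rank p j) (left_rank p (Suc j)))"
    using assms(2) left_rank_less by (intro sum_descent_weight_eq[symmetric])
  finally show ?thesis
    using pattern_sum_eq_sum_descent_weight[OF assms(1)] by simp
qed

section \<open>Equidistribution\<close>

lemma card_fibre_bij_betw: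
  assumes "bij_betw f X Y" "\<And>x. x \<in> X \<Longrightarrow> g x = h (f x)"
  shows "card {x. x \<in> X \<and> g x = k} = card {y \<in> Y. h y = k}"
proof -
  have "f ` {x. x \<in> X \<and> g x = k} = {y \<in> Y. h y = k}"
    using assms by (auto simp: bij_betw_def)
  moreover have "inj_on f {x. x \<in> X \<and> g x = k}"
    using assms(1) by (auto simp: bij_betw_def intro: inj_on_subset)
  ultimately show ?thesis by (metis card_image)
qed

theorem theorem4:
  shows "mahonian (\<lambda>n p. pat_a_cb n p + pat_b_ca n p + pat_b_ca n p + pat_ba n p)"
  unfolding mahonian_def
proof (intro allI impI)
  fix n :: nat and k :: int
  assume n: "1 \<le> n"
  let ?P = "{p. p permutes {1..n}}"
  \<comment> \<open>The common middle term is the distribution of the entry sum on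
    \<open>codes n\<close>, which each statistic reaches through its own bijection.\<close>
  have "card {p. p \<in> ?P \<and> int (pat_a_cb n p + pat_b_ca n p + pat_b_ca n p + pat_ba n p) = k}
      = card {c \<in> codes n. int (\<Sum>j\<in>{1..n}. c j) = k}"
    using pattern_sum_eq_sum_code[OF _ n]
    by (intro card_fibre_bij_betw[OF bij_betw_trans[OF bij_betw_code bij_betw_step_code]]) simp
  also have "\<dots> = card {p. p \<in> ?P \<and> int (inv_count n p) = k}"
    using inv_count_eq_sum_code
    by (intro card_fibre_bij_betw[OF bij_betw_trans[OF bij_betw_code bij_betw_co_code], symmetric])
      simp
  finally show "card {p. p permutes {1..n}
        \<and> int (pat_a_cb n p + pat_b_ca n p + pat_b_ca n p + pat_ba n p) = k}
      = card {p. p permutes {1..n} \<and> int (inv_count n p) = k}"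
    by simp
qed

end
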